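(* Let $k\ge 1$ and let $\underline{\lambda}=(r_k\ge r_{k-1}\ge\cdots\ge r_1\ge 0)$ be a partition with at most $k$ nonzero parts. The morphism $$E_{\epsilon^1\wedge\cdots\wedge\epsilon^k}:\mathbb{Z}[D]\longrightarrow \bigwedge^k M,\qquad P(D)\longmapsto P(D)\cdot(\epsilon^1\wedge\cdots\wedge\epsilon^k),$$ is an epimorphism. In fact, Giambelli's formula holds: $$\Delta_{\underline{\lambda}}(D)\,(\epsilon^1\wedge\cdots\wedge\epsilon^k)=\epsilon^{1+r_1}\wedge\cdots\wedge\epsilon^{k+r_k}.$$
   Context: $M=\bigoplus_{i\ge1}\mathbb{Z}\epsilon^i$ is the free $\mathbb{Z}$-module with basis $(\epsilon^1,\epsilon^2,\ldots)$, and for $j\ge0$ the endomorphism $D_j$ of $M$ is given by $D_j\epsilon^i=\epsilon^{i+j}$; put $D_t=\sum_{j\ge0}D_jt^j$. $D_t$ is extended to a map $D_t=\sum_{j\ge 0} D_jt^j:\bigwedge M\to(\bigwedge M)[[t]]$ by requiring it to be a $\mathbb{Z}$-algebra homomorphism, i.e. $D_t(\alpha\wedge\beta)=D_t\alpha\wedge D_t\beta$ (the Schubert derivation). Its coefficients $D_j$ preserve each $\bigwedge^kM$ and commute pairwise there. $\mathbb{Z}[D]$ is the commutative subring of $\mathrm{End}_{\mathbb{Z}}(\bigwedge^kM)$ generated by $D_1,D_2,\ldots$. Conventions: $D_0=\mathrm{id}$, $D_j=0$ for $j<0$. For $\underline{\lambda}=(r_k,\ldots,r_1)$, $\Delta_{\underline{\lambda}}(D)=\det\big(D_{r_j+j-i}\big)_{1\le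 i,j\le k}$ ($i$ the row index, $j$ the column index). *)

theory Defs
  imports
    "HOL-Library.Poly_Mapping"
    "HOL-Computational_Algebra.Formal_Power_Series"
    "HOL-Computational_Algebra.Group_Closure"
    "HOL-Combinatorics.Permutations"
    "HOL-Algebra.Generated_Rings"
begin

section \<open>The tensor algebra of a free abelian group\<close>

datatype 'b fword = FWord (letters: "'b list")

instantiation fword :: (type) monoid_add
begin
definition zero_fword_def: "0 = FWord []"
definition plus_fword_def: "v + w = FWord (letters v @ letters w)"
instance by standard (simp_all add: zero_fword_def plus_fword_def)
end

text \<open>The free abelian group on \<open>'b\<close> is \<open>'b \<Rightarrow>\<^sub>0 int\<close>. Its tensor algebra is the monoid ring
  \<open>'b fword \<Rightarrow>\<^sub>0 int\<close> of the free monoid on \<open>'b\<close>: the word \<open>b1 \<dots> bn\<close> stands for the tensor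
  \<open>b1 \<otimes> \<dots> \<otimes> bn\<close>, and the convolution product of \<^type>\<open>poly_mapping\<close> is the tensor product.\<close>

type_synonym 'b tensor = "'b fword \<Rightarrow>\<^sub>0 int"

definition tensor_incl :: "('b \<Rightarrow>\<^sub>0 int) \<Rightarrow> 'b tensor" where
  "tensor_incl = frag_extend (\<lambda>b. frag_of (FWord [b]))"

definition word_eval :: "('b \<Rightarrow> 'a::ring_1) \<Rightarrow> 'b tensor \<Rightarrow> 'a" where
  "word_eval g p = (\<Sum>w\<in>Poly_Mapping.keys p.
     of_int (Poly_Mapping.lookup p w) * prod_list (map g (letters w)))"

lemma word_eval_superset:
  assumes "finite S" "Poly_Mapping.keys p \<subseteq> S"
  shows "word_eval g p = (\<Sum>w\<in>S. of_int (Poly_Mapping.lookup p w) * prod_list (map g (letters w)))"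
  unfolding word_eval_def using assms
  by (intro sum.mono_neutral_left) (auto simp: in_keys_iff)

lemma word_eval_0 [simp]: "word_eval g 0 = 0"
  by (simp add: word_eval_def)

lemma word_eval_add: "word_eval g (p + q) = word_eval g p + word_eval g q"
proof -
  let ?S = "Poly_Mapping.keys p \<union> Poly_Mapping.keys q"
  have "Poly_Mapping.keys (p + q) \<subseteq> ?S" by (rule keys_add)
  then show ?thesis
    by (simp add: word_eval_superset[of ?S] lookup_add distrib_right sum.distrib)
qed

lemma word_eval_diff: "word_eval g (p - q) = word_eval g p - word_eval g q"
  using word_eval_add[of g "p - q" q] by (simp add: algebra_simps)

lemma word_eval_word [simp]: "word_eval g (frag_of w) = prod_list (map g (letters w))"
  by (simp add: word_eval_def)

lemma letters_zero [simp]: "letters 0 = []"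
  by (simp add: zero_fword_def)

lemma word_eval_one [simp]: "word_eval g 1 = 1"
proof -
  have "word_eval g (frag_of 0) = 1" by (simp only: word_eval_word letters_zero list.map prod_list.Nil)
  then show ?thesis by (simp only: single_one)
qed

lemma frag_of_mult: "frag_of v * frag_of w = frag_of (v + w)"
  by (simp add: mult_single)

lemma frag_induct [case_names zero one diff]:
  assumes "P 0" "\<And>b. P (frag_of b)" "\<And>x y. P x \<Longrightarrow> P y \<Longrightarrow> P (x - y)"
  shows "P x"
  by (rule frag_induction[of x UNIV P]) (use assms in auto)

lemma word_eval_mult: "word_eval g (p * q) = word_eval g p * word_eval g q"
proof (induction p rule: frag_induct)
  case (one v)
  show ?case
    by (induction q rule: frag_induct)
       (simp_all add: frag_of_mult plus_fword_def right_diff_distrib word_eval_diff)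
qed (simp_all add: left_diff_distrib word_eval_diff)

lemma tensor_incl_add: "tensor_incl (m + n) = tensor_incl m + tensor_incl n"
  by (simp add: tensor_incl_def frag_extend_add)

lemma tensor_incl_diff: "tensor_incl (m - n) = tensor_incl m - tensor_incl n"
  by (simp add: tensor_incl_def frag_extend_diff)

lemma tensor_incl_zero [simp]: "tensor_incl 0 = 0"
  by (simp add: tensor_incl_def)

lemma tensor_incl_of [simp]: "tensor_incl (frag_of b) = frag_of (FWord [b])"
  by (simp add: tensor_incl_def)

lemma word_eval_incl:
  assumes f: "\<And>m n. f (m + n) = f m + f n"
  shows "word_eval (\<lambda>b. f (frag_of b)) (tensor_incl m) = f m"
proof -
  have f0: "f 0 = 0" using f[of 0 0] by simp
  have fd: "f (m - n) = f m - f n" for m n using f[of "m - n" n] by (simp add: algebra_simps)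
  show ?thesis
    by (induction m rule: frag_induct) (simp_all add: f0 fd word_eval_diff tensor_incl_diff)
qed


section \<open>The exterior algebra\<close>

text \<open>The two-sided ideal generated by the squares \<open>m \<otimes> m\<close>.\<close>

definition alt_ideal :: "'b tensor set" where
  "alt_ideal = group_closure {a * (tensor_incl m * tensor_incl m) * b | a m b. True}"

lemma alt_ideal_gen: "a * (tensor_incl m * tensor_incl m) * b \<in> alt_ideal"
  unfolding alt_ideal_def by (rule group_closure.base) blast

lemma alt_ideal_zero [simp]: "0 \<in> alt_ideal"
  by (simp add: alt_ideal_def)

lemma alt_ideal_diff: "x \<in> alt_ideal \<Longrightarrow> y \<in> alt_ideal \<Longrightarrow> x - y \<in> alt_ideal"
  unfolding alt_ideal_def by (rule group_closure.diff)

lemma alt_ideal_add: "x \<in> alt_ideal \<Longrightarrow> y \<in> alt_ideal \<Longrightarrow> x + y \<in> alt_ideal"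
  unfolding alt_ideal_def by (rule group_closure_add)

lemma alt_ideal_minus_iff: "- x \<in> alt_ideal \<longleftrightarrow> x \<in> alt_ideal"
  unfolding alt_ideal_def by (rule group_closure_minus_iff)

lemma alt_ideal_minus_commute: "x - y \<in> alt_ideal \<longleftrightarrow> y - x \<in> alt_ideal"
  using alt_ideal_minus_iff[of "x - y"] by simp

lemma alt_ideal_induct [consumes 1, case_names zero gen diff]:
  assumes "x \<in> alt_ideal" "P 0" "\<And>a m b. P (a * (tensor_incl m * tensor_incl m) * b)"
    "\<And>x y. P x \<Longrightarrow> P y \<Longrightarrow> P (x - y)"
  shows "P x"
  using assms(1) unfolding alt_ideal_def
  by (induction rule: group_closure.induct) (use assms(2-4) in auto)

lemma alt_ideal_mult:
  assumes "x \<in> alt_ideal"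
  shows "a * x * b \<in> alt_ideal"
  using assms
proof (induction rule: alt_ideal_induct)
  case (gen c m d)
  show ?case using alt_ideal_gen[of "a * c" m "d * b"] by (simp add: mult.assoc)
next
  case (diff x y)
  then show ?case by (simp add: algebra_simps alt_ideal_diff)
qed simp

lemma alt_ideal_mult_cong:
  assumes "x - x' \<in> alt_ideal" "y - y' \<in> alt_ideal"
  shows "x * y - x' * y' \<in> alt_ideal"
proof -
  have "x * y - x' * y' = 1 * (x - x') * y + x' * (y - y') * 1"
    by (simp add: algebra_simps)
  then show ?thesis using assms by (simp only: alt_ideal_add alt_ideal_mult)
qed

lemma word_eval_alt_ideal:
  assumes "x \<in> alt_ideal" and f: "\<And>m n. f (m + n) = f m + f n" and sq: "\<And>m. f m * f m = 0"
  shows "word_eval (\<lambda>b. f (frag_of b)) x = 0"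
  using assms(1)
  by (induction rule: alt_ideal_induct) (simp_all add: word_eval_mult word_eval_diff word_eval_incl f sq)

lemma one_notin_alt_ideal: "1 \<notin> alt_ideal"
  using word_eval_alt_ideal[of 1 "\<lambda>_. 0 :: int"] by auto

quotient_type 'b exterior = "'b tensor" / "\<lambda>x y. x - y \<in> alt_ideal"
proof (rule equivpI)
  show "reflp (\<lambda>x y :: 'b tensor. x - y \<in> alt_ideal)" by (simp add: reflp_def)
  show "symp (\<lambda>x y :: 'b tensor. x - y \<in> alt_ideal)"
    by (simp add: symp_def alt_ideal_minus_commute)
  show "transp (\<lambda>x y :: 'b tensor. x - y \<in> alt_ideal)"
  proof (rule transpI)
    fix x y z :: "'b tensor"
    assume "x - y \<in> alt_ideal" "y - z \<in> alt_ideal"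
    then have "(x - y) + (y - z) \<in> alt_ideal" by (rule alt_ideal_add)
    then show "x - z \<in> alt_ideal" by simp
  qed
qed

text \<open>The multiplication of this ring is the wedge product.\<close>

instantiation exterior :: (type) ring_1
begin
lift_definition zero_exterior :: "'a exterior" is 0 .
lift_definition one_exterior :: "'a exterior" is 1 .
lift_definition plus_exterior :: "'a exterior \<Rightarrow> 'a exterior \<Rightarrow> 'a exterior" is "(+)"
  by (simp only: add_diff_add alt_ideal_add)
lift_definition minus_exterior :: "'a exterior \<Rightarrow> 'a exterior \<Rightarrow> 'a exterior" is "(-)"
proof -
  fix x x' y y' :: "'a tensor"
  assume "x - x' \<in> alt_ideal" "y - y' \<in> alt_ideal"
  moreover have "x - y - (x' - y') = (x - x') - (y - y')" by simp
  ultimately show "x - y - (x' - y') \<in> alt_ideal" by (simp only: alt_ideal_diff)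
qed
lift_definition uminus_exterior :: "'a exterior \<Rightarrow> 'a exterior" is uminus
  by (simp only: minus_diff_minus alt_ideal_minus_iff)
lift_definition times_exterior :: "'a exterior \<Rightarrow> 'a exterior \<Rightarrow> 'a exterior" is "(*)"
  by (rule alt_ideal_mult_cong)
instance
proof
  fix a b c :: "'a exterior"
  show "a * b * c = a * (b * c)" by transfer (simp add: mult.assoc)
  show "1 * a = a" by transfer simp
  show "a * 1 = a" by transfer simp
  show "a + b + c = a + (b + c)" by transfer (simp add: add.assoc)
  show "a + b = b + a" by transfer (simp add: add.commute)
  show "0 + a = a" by transfer simp
  show "- a + a = 0" by transfer simp
  show "a - b = a + - b" by transfer simp
  show "(a + b) * c = a * c + b * c" by transfer (simp add: distrib_right)
  show "a * (b + c) = a * b + a * c" by transfer (simp add: distrib_left)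
  show "(0 :: 'a exterior) \<noteq> 1" by transfer (simp add: one_notin_alt_ideal alt_ideal_minus_iff)
qed
end

lift_definition ext_incl :: "('b \<Rightarrow>\<^sub>0 int) \<Rightarrow> 'b exterior" is tensor_incl .

lemma ext_incl_add: "ext_incl (m + n) = ext_incl m + ext_incl n"
  by transfer (simp add: tensor_incl_add)

lemma ext_incl_square: "ext_incl m * ext_incl m = 0"
  by transfer (use alt_ideal_gen[of 1 _ 1] in simp)

text \<open>For unital rings, \<open>\<int>\<close>-linearity amounts to additivity.\<close>

definition alg_hom :: "('a::ring_1 \<Rightarrow> 'c::ring_1) \<Rightarrow> bool" where
  "alg_hom h \<longleftrightarrow> h 1 = 1 \<and> (\<forall>x y. h (x + y) = h x + h y) \<and> (\<forall>x y. h (x * y) = h x * h y)"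

lemma alg_hom_simps:
  assumes "alg_hom h"
  shows "h 1 = 1" "h 0 = 0" "h (x + y) = h x + h y" "h (x - y) = h x - h y" "h (x * y) = h x * h y"
proof -
  have a: "h (x + y) = h x + h y" for x y using assms by (simp add: alg_hom_def)
  show "h 1 = 1" "h (x + y) = h x + h y" "h (x * y) = h x * h y" using assms by (simp_all add: alg_hom_def)
  show "h 0 = 0" using a[of 0 0] by simp
  show "h (x - y) = h x - h y" using a[of "x - y" y] by (simp add: algebra_simps)
qed

lemma exterior_induct [case_names one incl mult diff]:
  assumes one: "P 1" and incl: "\<And>b. P (ext_incl (frag_of b))"
    and mult: "\<And>x y. P x \<Longrightarrow> P y \<Longrightarrow> P (x * y)" and diff: "\<And>x y. P x \<Longrightarrow> P y \<Longrightarrow> P (x - y)"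
  shows "P x"
proof -
  have w: "P (abs_exterior (frag_of (FWord bs)))" for bs
  proof (induction bs)
    case Nil
    then show ?case using one by (simp add: one_exterior_def flip: zero_fword_def)
  next
    case (Cons b bs)
    have "abs_exterior (frag_of (FWord (b # bs))) = ext_incl (frag_of b) * abs_exterior (frag_of (FWord bs))"
      by (simp add: ext_incl.abs_eq times_exterior.abs_eq frag_of_mult plus_fword_def)
    then show ?case using incl[of b] Cons mult by simp
  qed
  have "P (abs_exterior p)" for p
  proof (induction p rule: frag_induct)
    case zero
    then show ?case using diff[OF one one] by (simp add: zero_exterior_def)
  next
    case (one v)
    then show ?case using w[of "letters v"] by simp
  next
    case (diff x y)
    then show ?case using assms(4) by (metis minus_exterior.abs_eq)
  qed
  then show ?thesis by (metis Quotient3_abs_rep Quotient3_exterior)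
qed

theorem exterior_universal_property:
  fixes f :: "('b \<Rightarrow>\<^sub>0 int) \<Rightarrow> 'a::ring_1"
  assumes "\<And>m n. f (m + n) = f m + f n" and "\<And>m. f m * f m = 0"
  shows "\<exists>!h. alg_hom h \<and> (\<forall>m. h (ext_incl m) = f m)"
proof -
  let ?e = "word_eval (\<lambda>b. f (frag_of b))"
  have wd: "?e x = ?e y" if "x - y \<in> alt_ideal" for x y
    using word_eval_alt_ideal[OF that assms] by (simp add: word_eval_diff)
  define h where "h x = ?e (rep_exterior x)" for x
  have h: "h (abs_exterior p) = ?e p" for p
    unfolding h_def by (rule wd, rule rep_abs_rsp_left[OF Quotient3_exterior]) simp
  have ex: "\<exists>p. x = abs_exterior p" for x :: "'b exterior"
    by (metis Quotient3_abs_rep Quotient3_exterior)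
  show ?thesis
  proof (rule ex1I[of _ h])
    show "alg_hom h \<and> (\<forall>m. h (ext_incl m) = f m)"
      unfolding alg_hom_def
    proof (intro conjI allI)
      show "h 1 = 1" by (simp add: one_exterior_def h)
      show "h (ext_incl m) = f m" for m by (simp add: ext_incl.abs_eq h word_eval_incl assms)
      show "h (x + y) = h x + h y" for x y
        using ex[of x] ex[of y] by (auto simp: plus_exterior.abs_eq h word_eval_add)
      show "h (x * y) = h x * h y" for x y
        using ex[of x] ex[of y] by (auto simp: times_exterior.abs_eq h word_eval_mult)
    qed
    then have a: "alg_hom h" and b: "\<And>m. h (ext_incl m) = f m" by auto
    fix h' assume "alg_hom h' \<and> (\<forall>m. h' (ext_incl m) = f m)"
    then have a': "alg_hom h'" and b': "\<And>m. h' (ext_incl m) = f m" by auto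
    show "h' = h"
    proof
      show "h' x = h x" for x
        by (induction x rule: exterior_induct)
           (simp_all add: alg_hom_simps[OF a] alg_hom_simps[OF a'] b b')
    qed
  qed
qed

text \<open>The additive closure is the \<open>\<int>\<close>-span.\<close>

definition ext_power :: "nat \<Rightarrow> 'b exterior set" where
  "ext_power k = group_closure {prod_list (map ext_incl ms) | ms. length ms = k}"


section \<open>The Schubert derivation\<close>

text \<open>The basis of \<open>M\<close> is indexed from \<open>1\<close>, so \<open>\<epsilon>\<^sup>i\<close> is the generator number \<open>i - 1\<close> of
  \<open>nat \<Rightarrow>\<^sub>0 int\<close>; the value at \<open>i = 0\<close> is irrelevant.\<close>

definition eps :: "nat \<Rightarrow> (nat \<Rightarrow>\<^sub>0 int)" where
  "eps i = frag_of (i - 1)"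

definition shift :: "nat \<Rightarrow> (nat \<Rightarrow>\<^sub>0 int) \<Rightarrow> (nat \<Rightarrow>\<^sub>0 int)" where
  "shift j = frag_extend (\<lambda>i. frag_of (i + j))"

lemma shift_eps: "i \<ge> 1 \<Longrightarrow> shift j (eps i) = eps (i + j)"
  by (simp add: shift_def eps_def)

lemma shift_add: "shift j (m + n) = shift j m + shift j n"
  by (simp add: shift_def frag_extend_add)

definition schubert :: "nat exterior \<Rightarrow> nat exterior fps" where
  "schubert = (THE h. alg_hom h \<and> (\<forall>m. h (ext_incl m) = Abs_fps (\<lambda>j. ext_incl (shift j m))))"

lemma ext_incl_anticomm: "ext_incl m * ext_incl n = - (ext_incl n * ext_incl m)"
proof -
  have "ext_incl (m + n) * ext_incl (m + n) = 0" by (rule ext_incl_square)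
  then have "ext_incl m * ext_incl n + ext_incl n * ext_incl m = 0"
    by (simp add: ext_incl_add algebra_simps ext_incl_square)
  then show ?thesis by (simp add: eq_neg_iff_add_eq_0)
qed

lemma antisym_sum_zero:
  fixes f :: "nat \<Rightarrow> ('b \<Rightarrow>\<^sub>0 int)" and n :: nat
  shows "(\<Sum>i=0..n. ext_incl (f i) * ext_incl (f (n - i))) = 0"
proof (induction n arbitrary: f rule: nat_induct2)
  case 0
  then show ?case by (simp add: ext_incl_square)
next
  case 1
  then show ?case using ext_incl_anticomm[of "f 0" "f 1"] by simp
next
  case (step n)
  have "(\<Sum>i=0..n. ext_incl (f (Suc i)) * ext_incl (f (Suc n - i))) = 0"
    using step[of "f \<circ> Suc"] by (simp add: Suc_diff_le)
  moreover have "(\<Sum>i=0..n+2. ext_incl (f i) * ext_incl (f (n + 2 - i))) =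
      ext_incl (f 0) * ext_incl (f (n + 2)) +
      (\<Sum>i=0..n. ext_incl (f (Suc i)) * ext_incl (f (Suc n - i))) + ext_incl (f (n + 2)) * ext_incl (f 0)"
    using sum.atLeast0_atMost_Suc_shift[of "\<lambda>i. ext_incl (f i) * ext_incl (f (n + 2 - i))" n]
    by (simp add: o_def)
  ultimately show ?case using ext_incl_anticomm[of "f 0" "f (n + 2)"] by simp
qed

lemma schubert_exists:
  "\<exists>!h. alg_hom h \<and> (\<forall>m. h (ext_incl m) = Abs_fps (\<lambda>j. ext_incl (shift j m)))"
proof (rule exterior_universal_property)
  show "Abs_fps (\<lambda>j. ext_incl (shift j (m + n))) =
    Abs_fps (\<lambda>j. ext_incl (shift j m)) + Abs_fps (\<lambda>j. ext_incl (shift j n))" for m n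
    by (simp add: fps_eq_iff shift_add ext_incl_add)
  show "Abs_fps (\<lambda>j. ext_incl (shift j m)) * Abs_fps (\<lambda>j. ext_incl (shift j m)) = 0" for m
    using antisym_sum_zero[of "\<lambda>i. shift i m"] by (simp add: fps_eq_iff fps_mult_nth)
qed

lemma schubert: "alg_hom schubert" "schubert (ext_incl m) = Abs_fps (\<lambda>j. ext_incl (shift j m))"
  using theI'[OF schubert_exists] unfolding schubert_def by auto

definition schubert_D :: "nat \<Rightarrow> nat exterior \<Rightarrow> nat exterior" where
  "schubert_D j x = fps_nth (schubert x) j"

lemma schubert_D_simps:
  "schubert_D n 1 = (if n = 0 then 1 else 0)"
  "schubert_D n 0 = 0"
  "schubert_D n (x + y) = schubert_D n x + schubert_D n y"
  "schubert_D n (x - y) = schubert_D n x - schubert_D n y"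
  "schubert_D n (ext_incl m) = ext_incl (shift n m)"
  by (simp_all add: schubert_D_def alg_hom_simps[OF schubert(1)] schubert(2))

lemma schubert_D_sum: "schubert_D n (sum f A) = (\<Sum>i\<in>A. schubert_D n (f i))"
  by (induction A rule: infinite_finite_induct) (simp_all add: schubert_D_simps)

lemma schubert_D_mult: "schubert_D n (x * y) = (\<Sum>i=0..n. schubert_D i x * schubert_D (n - i) y)"
  by (simp add: schubert_D_def alg_hom_simps[OF schubert(1)] fps_mult_nth)

lemma schubert_D_eps: "i \<ge> 1 \<Longrightarrow> schubert_D j (ext_incl (eps i)) = ext_incl (eps (i + j))"
  by (simp add: schubert_D_simps shift_eps)

lemma shift_commute: "shift i (shift j m) = shift j (shift i m)"
proof (induction m rule: frag_induct)
  case (one b)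
  then show ?case by (simp add: shift_def add.assoc add.commute[of i j])
qed (simp_all add: shift_def frag_extend_diff)

lemma shift_0: "shift 0 m = m"
  by (induction m rule: frag_induct) (simp_all add: shift_def frag_extend_diff)

lemma schubert_D_0: "schubert_D 0 x = x"
  by (induction x rule: exterior_induct) (simp_all add: schubert_D_simps schubert_D_mult shift_0)

lemma schubert_D_commute: "schubert_D m (schubert_D n x) = schubert_D n (schubert_D m x)"
proof (induction x arbitrary: m n rule: exterior_induct)
  case (mult x y)
  have "schubert_D m (schubert_D n (x * y)) = (\<Sum>j=0..n. \<Sum>i=0..m.
      schubert_D i (schubert_D j x) * schubert_D (m - i) (schubert_D (n - j) y))"
    by (simp add: schubert_D_mult schubert_D_sum)
  also have "\<dots> = (\<Sum>j=0..n. \<Sum>i=0..m.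
      schubert_D j (schubert_D i x) * schubert_D (n - j) (schubert_D (m - i) y))"
    using mult by simp
  also have "\<dots> = (\<Sum>i=0..m. \<Sum>j=0..n.
      schubert_D j (schubert_D i x) * schubert_D (n - j) (schubert_D (m - i) y))"
    by (rule sum.swap)
  also have "\<dots> = schubert_D n (schubert_D m (x * y))"
    by (simp add: schubert_D_mult schubert_D_sum)
  finally show ?case .
qed (simp_all add: schubert_D_simps shift_commute)

lemma ext_power_zero: "0 \<in> ext_power k"
  by (simp add: ext_power_def)

lemma ext_power_add: "x \<in> ext_power k \<Longrightarrow> y \<in> ext_power k \<Longrightarrow> x + y \<in> ext_power k"
  unfolding ext_power_def by (rule group_closure_add)

lemma ext_power_diff: "x \<in> ext_power k \<Longrightarrow> y \<in> ext_power k \<Longrightarrow> x - y \<in> ext_power k"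
  unfolding ext_power_def by (rule group_closure.diff)

lemma ext_power_sum: "(\<And>i. i \<in> A \<Longrightarrow> f i \<in> ext_power k) \<Longrightarrow> sum f A \<in> ext_power k"
  by (induction A rule: infinite_finite_induct) (simp_all add: ext_power_zero ext_power_add)

lemma ext_power_prod: "length ms = k \<Longrightarrow> prod_list (map ext_incl ms) \<in> ext_power k"
  unfolding ext_power_def by (rule group_closure.base) blast

lemma ext_power_induct [consumes 1, case_names zero prod diff]:
  assumes "x \<in> ext_power k" "P 0" "\<And>ms. length ms = k \<Longrightarrow> P (prod_list (map ext_incl ms))"
    "\<And>x y. P x \<Longrightarrow> P y \<Longrightarrow> P (x - y)"
  shows "P x"
  using assms(1) unfolding ext_power_def
  by (induction rule: group_closure.induct) (use assms(2-4) in auto)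

lemma ext_power_Suc: "x \<in> ext_power k \<Longrightarrow> ext_incl m * x \<in> ext_power (Suc k)"
proof (induction x rule: ext_power_induct)
  case (prod ms)
  then show ?case using ext_power_prod[of "m # ms" "Suc k"] by simp
qed (simp_all add: ext_power_zero right_diff_distrib ext_power_diff)

lemma schubert_D_ext_power: "x \<in> ext_power k \<Longrightarrow> schubert_D n x \<in> ext_power k"
proof (induction x rule: ext_power_induct)
  case (prod ms)
  have "schubert_D n (prod_list (map ext_incl ms)) \<in> ext_power (length ms)"
  proof (induction ms arbitrary: n)
    case Nil
    have "(1 :: nat exterior) \<in> ext_power 0" using ext_power_prod[of "[]" 0] by simp
    then show ?case by (simp add: schubert_D_simps ext_power_zero)
  next
    case (Cons m ms)
    then show ?case by (simp add: schubert_D_mult schubert_D_simps ext_power_sum ext_power_Suc)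
  qed
  then show ?case by (simp add: prod)
qed (simp_all add: schubert_D_simps ext_power_zero ext_power_diff)


section \<open>The ring generated by the Schubert derivation\<close>

definition End_ring :: "('a, 'b) monoid_scheme \<Rightarrow> ('a \<Rightarrow> 'a) ring" where
  "End_ring G = \<lparr>carrier = hom G G \<inter> extensional (carrier G),
     mult = compose (carrier G), one = (\<lambda>x\<in>carrier G. x),
     zero = (\<lambda>x\<in>carrier G. \<one>\<^bsub>G\<^esub>), add = (\<lambda>f g. \<lambda>x\<in>carrier G. f x \<otimes>\<^bsub>G\<^esub> g x)\<rparr>"

lemma ring_End_ring:
  fixes G (structure)
  assumes "comm_group G"
  shows "ring (End_ring G)"
proof -
  interpret comm_group G by fact
  let ?E = "End_ring G"
  have mem: "f \<in> carrier ?E \<longleftrightarrow> f \<in> extensional (carrier G) \<and> (\<forall>x\<in>carrier G. f x \<in> carrier G) \<and>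
      (\<forall>x\<in>carrier G. \<forall>y\<in>carrier G. f (x \<otimes> y) = f x \<otimes> f y)" for f
    by (auto simp: End_ring_def hom_def)
  have closed: "f x \<in> carrier G" if "f \<in> carrier ?E" "x \<in> carrier G" for f x
    using that mem by blast
  have hom: "f (x \<otimes> y) = f x \<otimes> f y" if "f \<in> carrier ?E" "x \<in> carrier G" "y \<in> carrier G" for f x y
    using that mem by blast
  have one: "f \<one> = \<one>" if "f \<in> carrier ?E" for f
    using that by (intro hom_one is_group) (auto simp: End_ring_def)
  have ext: "f = g" if "f \<in> carrier ?E" "g \<in> carrier ?E" "\<And>x. x \<in> carrier G \<Longrightarrow> f x = g x" for f g
    using that mem by (blast intro: extensionalityI)
  have ap: "(f \<oplus>\<^bsub>?E\<^esub> g) x = f x \<otimes> g x" "(f \<otimes>\<^bsub>?E\<^esub> g) x = f (g x)" "\<zero>\<^bsub>?E\<^esub> x = \<one>" "\<one>\<^bsub>?E\<^esub> x = x"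
    if "x \<in> carrier G" for f g x
    using that by (simp_all add: End_ring_def compose_def)
  have exts: "f \<oplus>\<^bsub>?E\<^esub> g \<in> extensional (carrier G)" "f \<otimes>\<^bsub>?E\<^esub> g \<in> extensional (carrier G)"
    "\<zero>\<^bsub>?E\<^esub> \<in> extensional (carrier G)" "\<one>\<^bsub>?E\<^esub> \<in> extensional (carrier G)" for f g
    by (simp_all add: End_ring_def)
  have addc: "f \<oplus>\<^bsub>?E\<^esub> g \<in> carrier ?E" if "f \<in> carrier ?E" "g \<in> carrier ?E" for f g
    unfolding mem using that by (simp add: exts ap closed hom m_ac)
  have multc: "f \<otimes>\<^bsub>?E\<^esub> g \<in> carrier ?E" if "f \<in> carrier ?E" "g \<in> carrier ?E" for f g
    unfolding mem using that by (simp add: exts ap closed hom)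
  have zeroc: "\<zero>\<^bsub>?E\<^esub> \<in> carrier ?E" unfolding mem by (simp add: exts ap)
  have onec: "\<one>\<^bsub>?E\<^esub> \<in> carrier ?E" unfolding mem by (simp add: exts ap)
  have neg: "\<exists>g\<in>carrier ?E. g \<oplus>\<^bsub>?E\<^esub> f = \<zero>\<^bsub>?E\<^esub>" if f: "f \<in> carrier ?E" for f
  proof
    let ?g = "\<lambda>x\<in>carrier G. inv (f x)"
    show g: "?g \<in> carrier ?E" unfolding mem using f by (simp add: closed hom inv_mult)
    show "?g \<oplus>\<^bsub>?E\<^esub> f = \<zero>\<^bsub>?E\<^esub>"
      by (rule ext) (simp_all add: addc g f zeroc ap closed)
  qed
  note c = addc multc zeroc onec closed
  show ?thesis
  proof (rule ringI)
    show "abelian_group ?E"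
    proof (rule abelian_groupI)
      fix f g h assume "f \<in> carrier ?E" "g \<in> carrier ?E" "h \<in> carrier ?E"
      then show "f \<oplus>\<^bsub>?E\<^esub> g \<oplus>\<^bsub>?E\<^esub> h = f \<oplus>\<^bsub>?E\<^esub> (g \<oplus>\<^bsub>?E\<^esub> h)"
        by (intro ext) (simp_all add: c ap m_assoc)
    next
      fix f g assume "f \<in> carrier ?E" "g \<in> carrier ?E"
      then show "f \<oplus>\<^bsub>?E\<^esub> g = g \<oplus>\<^bsub>?E\<^esub> f"
        by (intro ext) (simp_all add: c ap m_comm)
    next
      fix f assume "f \<in> carrier ?E"
      then show "\<zero>\<^bsub>?E\<^esub> \<oplus>\<^bsub>?E\<^esub> f = f"
        by (intro ext) (simp_all add: c ap)
    qed (simp_all add: c neg)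
    show "monoid ?E"
    proof (rule monoidI)
      fix f g h assume "f \<in> carrier ?E" "g \<in> carrier ?E" "h \<in> carrier ?E"
      then show "f \<otimes>\<^bsub>?E\<^esub> g \<otimes>\<^bsub>?E\<^esub> h = f \<otimes>\<^bsub>?E\<^esub> (g \<otimes>\<^bsub>?E\<^esub> h)"
        by (intro ext) (simp_all add: c ap)
    next
      fix f assume "f \<in> carrier ?E"
      then show "\<one>\<^bsub>?E\<^esub> \<otimes>\<^bsub>?E\<^esub> f = f" "f \<otimes>\<^bsub>?E\<^esub> \<one>\<^bsub>?E\<^esub> = f"
        by (intro ext; simp add: c ap)+
    qed (simp_all add: c)
    fix f g h assume "f \<in> carrier ?E" "g \<in> carrier ?E" "h \<in> carrier ?E"
    then show "(f \<oplus>\<^bsub>?E\<^esub> g) \<otimes>\<^bsub>?E\<^esub> h = f \<otimes>\<^bsub>?E\<^esub> h \<oplus>\<^bsub>?E\<^esub> g \<otimes>\<^bsub>?E\<^esub> h"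
      "h \<otimes>\<^bsub>?E\<^esub> (f \<oplus>\<^bsub>?E\<^esub> g) = h \<otimes>\<^bsub>?E\<^esub> f \<oplus>\<^bsub>?E\<^esub> h \<otimes>\<^bsub>?E\<^esub> g"
      by (intro ext; simp add: c ap hom)+
  qed
qed

text \<open>The additive group of the \<open>k\<close>-th exterior power, as a group record.\<close>

definition ext_power_group :: "nat \<Rightarrow> 'b exterior monoid" where
  "ext_power_group k = \<lparr>carrier = ext_power k, mult = (+), one = 0\<rparr>"

lemma comm_group_ext_power: "comm_group (ext_power_group k)"
proof (rule comm_groupI)
  fix x :: "'a exterior" assume "x \<in> carrier (ext_power_group k)"
  then show "\<exists>y\<in>carrier (ext_power_group k). y \<otimes>\<^bsub>ext_power_group k\<^esub> x = \<one>\<^bsub>ext_power_group k\<^esub>"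
    using ext_power_diff[of 0 k x] by (intro bexI[of _ "- x"]) (auto simp: ext_power_group_def ext_power_zero)
qed (auto simp: ext_power_group_def ext_power_zero ext_power_add add_ac)

definition schubert_End :: "nat \<Rightarrow> nat \<Rightarrow> nat exterior \<Rightarrow> nat exterior" where
  "schubert_End k j = (\<lambda>x\<in>ext_power k. schubert_D j x)"

text \<open>The ring \<open>\<int>[D]\<close> of endomorphisms of the \<open>k\<close>-th exterior power; \<open>D\<^sub>j\<close> maps this power
  to itself (\<open>schubert_D_ext_power\<close>), and elements of the ring are \<^const>\<open>undefined\<close> outside it.\<close>

definition schubert_ring :: "nat \<Rightarrow> (nat exterior \<Rightarrow> nat exterior) ring" where
  "schubert_ring k = (End_ring (ext_power_group k))
     \<lparr>carrier := generate_ring (End_ring (ext_power_group k)) (schubert_End k ` {1..})\<rparr>"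

lemma schubert_End_carrier: "schubert_End k j \<in> carrier (End_ring (ext_power_group k))"
  by (auto simp: schubert_End_def End_ring_def ext_power_group_def hom_def schubert_D_ext_power
      ext_power_add schubert_D_simps)

lemma generate_ring_commute:
  fixes R (structure)
  assumes "ring R" and H: "H \<subseteq> carrier R"
    and comm: "\<And>x y. x \<in> H \<Longrightarrow> y \<in> H \<Longrightarrow> x \<otimes>\<^bsub>R\<^esub> y = y \<otimes>\<^bsub>R\<^esub> x"
    and xy: "x \<in> generate_ring R H" "y \<in> generate_ring R H"
  shows "x \<otimes>\<^bsub>R\<^esub> y = y \<otimes>\<^bsub>R\<^esub> x"
proof -
  interpret ring R by fact
  note c = generate_ring_in_carrier[OF H]
  have step: "x \<otimes>\<^bsub>R\<^esub> z = z \<otimes>\<^bsub>R\<^esub> x"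
    if x: "x \<in> generate_ring R H" and z: "z \<in> carrier R"
      and h: "\<And>h. h \<in> H \<Longrightarrow> h \<otimes>\<^bsub>R\<^esub> z = z \<otimes>\<^bsub>R\<^esub> h" for x z
    using x
  proof (induction rule: generate_ring.induct)
    case (eng_mult h1 h2)
    have "h1 \<otimes> h2 \<otimes> z = h1 \<otimes> (z \<otimes> h2)" using eng_mult z c by (simp add: m_assoc)
    also have "\<dots> = z \<otimes> (h1 \<otimes> h2)" using eng_mult z c by (simp flip: m_assoc)
    finally show ?case .
  qed (use z h c in \<open>auto simp: l_minus r_minus l_distr r_distr\<close>)
  show ?thesis
  proof (rule step[OF xy(1) c[OF xy(2)]])
    fix h assume "h \<in> H"
    then have "y \<otimes> h = h \<otimes> y" by (intro step[OF xy(2)]) (use H comm in auto)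
    then show "h \<otimes> y = y \<otimes> h" by simp
  qed
qed

lemma cring_schubert_ring: "cring (schubert_ring k)"
proof -
  let ?R = "End_ring (ext_power_group k) :: (nat exterior \<Rightarrow> nat exterior) ring"
  interpret R: ring ?R by (rule ring_End_ring[OF comm_group_ext_power])
  have H: "schubert_End k ` {1..} \<subseteq> carrier ?R" using schubert_End_carrier by auto
  have comm: "x \<otimes>\<^bsub>?R\<^esub> y = y \<otimes>\<^bsub>?R\<^esub> x"
    if "x \<in> schubert_End k ` {1..}" "y \<in> schubert_End k ` {1..}" for x y
    using that by (auto simp: End_ring_def ext_power_group_def compose_def schubert_End_def
        schubert_D_ext_power schubert_D_commute fun_eq_iff)
  interpret Z: ring "schubert_ring k"
    unfolding schubert_ring_def by (rule R.generate_ring_is_ring[OF H])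
  show ?thesis
    by standard (use generate_ring_commute[OF R.ring_axioms H comm] in \<open>auto simp: schubert_ring_def\<close>)
qed

text \<open>The entries \<open>D\<^sub>n\<close> for integer \<open>n\<close>, where \<open>D\<^sub>n = 0\<close> for \<open>n < 0\<close>.\<close>

definition schubert_coeff :: "nat \<Rightarrow> int \<Rightarrow> nat exterior \<Rightarrow> nat exterior" where
  "schubert_coeff k n = (if n < 0 then \<zero>\<^bsub>schubert_ring k\<^esub> else schubert_End k (nat n))"

lemma schubert_coeff_carrier: "schubert_coeff k n \<in> carrier (schubert_ring k)"
proof -
  interpret cring "schubert_ring k" by (rule cring_schubert_ring)
  have "schubert_End k 0 = \<one>\<^bsub>schubert_ring k\<^esub>"
    by (simp add: schubert_End_def schubert_ring_def End_ring_def ext_power_group_def schubert_D_0)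
  moreover have "schubert_End k j \<in> carrier (schubert_ring k)" if "j \<ge> 1" for j
    using that by (auto simp: schubert_ring_def intro: generate_ring.incl)
  ultimately have "schubert_End k j \<in> carrier (schubert_ring k)" for j
    by (cases j) auto
  then show ?thesis by (simp add: schubert_coeff_def)
qed

text \<open>Leibniz formula; meaningful in a commutative ring.\<close>

definition ring_det :: "('a, 'b) ring_scheme \<Rightarrow> nat \<Rightarrow> (nat \<Rightarrow> nat \<Rightarrow> 'a) \<Rightarrow> 'a" where
  "ring_det R k A = (\<Oplus>\<^bsub>R\<^esub>p\<in>{p. p permutes {1..k}}.
     [sign p] \<cdot>\<^bsub>R\<^esub> (\<Otimes>\<^bsub>R\<^esub>i\<in>{1..k}. A i (p i)))"

text \<open>A partition \<open>(r\<^sub>k, \<dots>, r\<^sub>1)\<close> is given as the function \<open>i \<mapsto> r\<^sub>i\<close> on \<open>{1..k}\<close>.\<close>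

definition schubert_Delta :: "nat \<Rightarrow> (nat \<Rightarrow> nat) \<Rightarrow> nat exterior \<Rightarrow> nat exterior" where
  "schubert_Delta k r =
     ring_det (schubert_ring k) k (\<lambda>i j. schubert_coeff k (int (r j) + int j - int i))"

definition wedge_eps :: "nat list \<Rightarrow> nat exterior" where
  "wedge_eps js = prod_list (map (\<lambda>i. ext_incl (eps i)) js)"

end

theory Submission
  imports Defs
begin

text \<open>Write \<open>w = \<epsilon>\<^sup>1 \<and> \<dots> \<and> \<epsilon>\<^sup>k\<close>. Giambelli's formula is proved for all sequences of indices \<open>a\<^sub>j \<ge> 1\<close>,
  sorted or not: \<open>F(a) = \<epsilon>\<^bsup>a\<^sub>1\<^esup> \<and> \<dots> \<and> \<epsilon>\<^bsup>a\<^sub>k\<^esup>\<close> equals \<open>G(a) = det(D\<^bsub>a\<^sub>j - i\<^esub>) w\<close>. The partition \<open>r\<close> is the case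
  \<open>a\<^sub>j = j + r\<^sub>j\<close>. Since the \<open>F(a)\<close> span the exterior power and the determinants lie in \<open>\<int>[D]\<close>,
  surjectivity follows at once.

  Both sides satisfy the same linear recurrence in each index. Let \<open>E\<^sub>t = \<Sum> E\<^sub>l t\<^sup>l\<close> be the inverse of the
  series \<open>D\<^sub>t\<close>; it is again multiplicative for the wedge product, and \<open>E\<^sub>t \<epsilon>\<^sup>i = \<epsilon>\<^sup>i - t \<epsilon>\<^bsup>i+1\<^esup>\<close>. If
  \<open>a\<^sub>j > k\<close>, then \<open>\<Sum>\<^sub>l E\<^sub>l X(a - l e\<^sub>j) = 0\<close>, where \<open>l\<close> runs through \<open>0 \<le> l < a\<^sub>j\<close> and \<open>e\<^sub>j\<close> is the
  \<open>j\<close>-th unit vector, both for \<open>X = F\<close> and for \<open>X = G\<close>: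

  \<^item> For \<open>F\<close>, moving the \<open>j\<close>-th factor to the front makes the sum telescope to
    \<open>\<epsilon>\<^sup>1 \<and> E\<^sub>m \<beta>\<close>, up to sign, with \<open>m = a\<^sub>j - 1 \<ge> k\<close> and \<open>\<beta>\<close> the product of the other \<open>k - 1\<close> vectors. On
    such a product \<open>E\<^sub>t\<close> has degree at most \<open>k - 1\<close> in \<open>t\<close>, so \<open>E\<^sub>m \<beta> = 0\<close> (\<open>wedge_seq_recurrence\<close>).
  \<^item> For \<open>G\<close>, every term of the Leibniz formula contains exactly one entry of column \<open>j\<close>, and the sum
    over \<open>l\<close> replaces it by a coefficient of positive degree of \<open>E\<^sub>t D\<^sub>t = id\<close> (\<open>det_apply_recurrence\<close>).

  As \<open>E\<^sub>0 = id\<close>, the recurrence expresses \<open>F(a)\<close> and \<open>G(a)\<close> through sequences with smaller sum, so by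
  induction only sequences with values in \<open>{1..k}\<close> remain. If two values agree, both
  sides vanish; otherwise \<open>a\<close> is a permutation and both sides are \<open>sign a\<close> times \<open>w\<close>, because the
  matrix \<open>D\<^bsub>j - i\<^esub>\<close> is unitriangular.\<close>

section \<open>Additivity of the Schubert operators\<close>

lemma additive_schubert_D: "Modules.additive (schubert_D n)"
  by unfold_locales (simp add: schubert_D_simps)

lemma additive_of_int:
  fixes f :: "'a::ring_1 \<Rightarrow> 'b::ring_1"
  assumes "Modules.additive f"
  shows "f (of_int c * x) = of_int c * f x"
proof -
  interpret additive f by fact
  have nat: "f (of_nat n * x) = of_nat n * f x" for n
    by (induction n) (simp_all add: zero add distrib_right)
  show ?thesis
    by (cases c rule: int_cases2) (simp_all add: nat minus)
qed

section \<open>The inverse of the Schubert derivation\<close>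

text \<open>The coefficients \<open>E\<^sub>n\<close> of the inverse \<open>E\<^sub>t\<close> of the series \<open>D\<^sub>t\<close>, obtained by solving
  \<open>D\<^sub>t E\<^sub>t = id\<close> degree by degree.\<close>

fun schubert_Dinv :: "nat \<Rightarrow> nat exterior \<Rightarrow> nat exterior" where
  "schubert_Dinv 0 x = x"
| "schubert_Dinv (Suc n) x = - (\<Sum>j\<le>n. schubert_D (Suc j) (schubert_Dinv (n - j) x))"

declare schubert_Dinv.simps(2) [simp del]

lemma sum_D_Dinv:
  assumes "n \<ge> 1"
  shows "(\<Sum>j\<le>n. schubert_D j (schubert_Dinv (n - j) x)) = 0"
proof -
  obtain m where "n = Suc m" using assms by (cases n) auto
  then show ?thesis
    by (simp add: sum.atMost_Suc_shift schubert_D_0 schubert_Dinv.simps del: sum.atMost_Suc)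
qed

lemma additive_schubert_Dinv: "Modules.additive (schubert_Dinv n)"
proof (unfold_locales, induction n rule: less_induct)
  case (less n)
  show ?case
    by (cases n) (simp_all add: schubert_Dinv.simps less schubert_D_simps sum.distrib)
qed

lemma schubert_D_Dinv_commute: "schubert_D m (schubert_Dinv n x) = schubert_Dinv n (schubert_D m x)"
proof (induction n rule: less_induct)
  case (less n)
  show ?case
    by (cases n) (simp_all add: schubert_Dinv.simps less schubert_D_sum
        additive.minus[OF additive_schubert_D] schubert_D_commute[of m])
qed

lemma sum_Dinv_D:
  assumes "n \<ge> 1"
  shows "(\<Sum>l\<le>n. schubert_Dinv l (schubert_D (n - l) x)) = 0"
proof -
  have "(\<Sum>l\<le>n. schubert_Dinv l (schubert_D (n - l) x))
      = (\<Sum>j\<le>n. schubert_D j (schubert_Dinv (n - j) x))"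
    by (rule sum.reindex_bij_witness[of _ "\<lambda>j. n - j" "\<lambda>j. n - j"])
       (auto simp: schubert_D_Dinv_commute)
  then show ?thesis using sum_D_Dinv[OF assms] by simp
qed

lemma schubert_Dinv_one: "schubert_Dinv n 1 = (if n = 0 then 1 else 0)"
proof (induction n rule: less_induct)
  case (less n)
  show ?case
    by (cases n) (auto simp: schubert_Dinv.simps less schubert_D_simps intro!: sum.neutral)
qed

text \<open>Expanded by the Leibniz rule, \<open>D\<^sub>n (m \<and> x)\<close> and \<open>D\<^bsub>n-1\<^esub> (D\<^sub>1 m \<and> x)\<close> have the same terms except for the
  first term \<open>m \<and> D\<^sub>n x\<close> of the former. In generating functions this is \<open>m \<and> D\<^sub>t x = D\<^sub>t (E\<^sub>t m \<and> x)\<close>, written without \<open>E\<^sub>t\<close> because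
  \<open>E\<^sub>t m = m - t D\<^sub>1 m\<close> for vectors \<open>m\<close>.\<close>

lemma schubert_D_incl_mult:
  "schubert_D n (ext_incl m * x)
    = ext_incl m * schubert_D n x + (if n = 0 then 0 else schubert_D (n - 1) (ext_incl (shift 1 m) * x))"
proof (cases n)
  case 0
  then show ?thesis by (simp add: schubert_D_0)
next
  case (Suc n')
  have shift_Suc: "shift i (shift (Suc 0) m) = shift (Suc i) m" for i
    by (induction m rule: frag_induct) (simp_all add: shift_def frag_extend_diff)
  show ?thesis
    by (simp add: shift_Suc Suc schubert_D_mult schubert_D_simps sum.atLeast0_atMost_Suc_shift shift_0
        del: sum.cl_ivl_Suc)
qed

text \<open>Multiplicativity of \<open>E\<^sub>t\<close> when one factor is a vector: \<open>E\<^sub>t (m \<and> x) = (m - t D\<^sub>1 m) \<and> E\<^sub>t x\<close>. The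
  coefficients \<open>R n\<close> of the right-hand side solve \<open>D\<^sub>t R = m \<and> x\<close> by the previous lemma, and
  this equation determines them recursively.\<close>

lemma schubert_Dinv_incl_mult:
  "schubert_Dinv n (ext_incl m * x)
    = ext_incl m * schubert_Dinv n x - (if n = 0 then 0 else ext_incl (shift 1 m) * schubert_Dinv (n - 1) x)"
proof (induction n arbitrary: m rule: less_induct)
  case (less n)
  show ?case
  proof (cases n)
    case 0
    then show ?thesis by simp
  next
    case (Suc k)
    define R where "R i = ext_incl m * schubert_Dinv i x -
        (if i = 0 then 0 else ext_incl (shift 1 m) * schubert_Dinv (i - 1) x)" for i
    let ?A = "\<lambda>j. schubert_D j (ext_incl (shift 1 m) * schubert_Dinv (k - j) x)"
    have "(\<Sum>j\<le>n. schubert_D j (R (n - j)))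
        = (\<Sum>j\<le>n. schubert_D j (ext_incl m * schubert_Dinv (n - j) x)) - (\<Sum>j\<le>k. ?A j)"
      by (simp add: R_def Suc schubert_D_simps sum_subtractf Suc_diff_le)
    also have "(\<Sum>j\<le>n. schubert_D j (ext_incl m * schubert_Dinv (n - j) x))
        = (\<Sum>j\<le>n. ext_incl m * schubert_D j (schubert_Dinv (n - j) x)) + (\<Sum>j\<le>k. ?A j)"
      by (simp add: schubert_D_incl_mult[of _ m] Suc sum.distrib sum.atMost_Suc_shift schubert_D_0
          del: sum.atMost_Suc)
    also have "(\<Sum>j\<le>n. ext_incl m * schubert_D j (schubert_Dinv (n - j) x)) = 0"
      unfolding sum_distrib_left[symmetric] using sum_D_Dinv[of n x] Suc by simp
    finally have "(\<Sum>j\<le>n. schubert_D j (R (n - j))) = 0" by simp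
    then have "R n = - (\<Sum>j\<le>k. schubert_D (Suc j) (R (k - j)))"
      by (simp add: Suc sum.atMost_Suc_shift schubert_D_0 eq_neg_iff_add_eq_0 del: sum.atMost_Suc)
    also have "\<dots> = - (\<Sum>j\<le>k. schubert_D (Suc j) (schubert_Dinv (k - j) (ext_incl m * x)))"
      using less by (simp add: R_def Suc)
    finally show ?thesis by (simp add: Suc schubert_Dinv.simps(2) R_def)
  qed
qed

text \<open>On a product of \<open>p\<close> vectors, \<open>E\<^sub>t\<close> is a product of \<open>p\<close> factors that are linear in \<open>t\<close>.\<close>

lemma schubert_Dinv_eq_0:
  "length ms < n \<Longrightarrow> schubert_Dinv n (prod_list (map ext_incl ms)) = 0"
  by (induction ms arbitrary: n) (simp_all add: schubert_Dinv_one schubert_Dinv_incl_mult)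

text \<open>The recurrence for wedge products in its first position. The summands are
  \<open>\<epsilon>\<^bsup>a-l\<^esup> \<and> E\<^sub>l x - \<epsilon>\<^bsup>a-l+1\<^esup> \<and> E\<^bsub>l-1\<^esub> x\<close>, so the sum telescopes, and what is left
  vanishes because \<open>x\<close> has too few factors. This plays the role of the Cayley-Hamilton theorem.\<close>

lemma sum_Dinv_eps_mult:
  assumes "Suc (length ms) < a"
  shows "(\<Sum>l<a. schubert_Dinv l (ext_incl (eps (a - l)) * prod_list (map ext_incl ms))) = 0"
proof -
  let ?x = "prod_list (map ext_incl ms)"
  have "(\<Sum>l<Suc L. schubert_Dinv l (ext_incl (eps (a - l)) * ?x)) = ext_incl (eps (a - L)) * schubert_Dinv L ?x"
    if "L < a" for L
    using that
  proof (induction L)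
    case (Suc L)
    then have "shift 1 (eps (a - Suc L)) = eps (a - L)" by (simp add: shift_eps Suc_diff_Suc)
    then show ?case using Suc by (simp add: schubert_Dinv_incl_mult)
  qed simp
  from this[of "a - 1"] assms show ?thesis by (simp add: schubert_Dinv_eq_0)
qed

section \<open>Wedge products of families of vectors\<close>

text \<open>The sign \<open>s\<close> depends on the position only, not on the vectors; this uniformity is what allows
  the lemma to be used for linearity and for recurrences in one position.\<close>

lemma wedge_move_to_front:
  fixes xs :: "'i list"
  assumes "distinct xs" "j \<in> set xs"
  shows "\<exists>s::int. \<forall>v :: 'i \<Rightarrow> 'b \<Rightarrow>\<^sub>0 int. prod_list (map (\<lambda>i. ext_incl (v i)) xs)
    = of_int s * (ext_incl (v j) * prod_list (map ext_incl (map v (remove1 j xs))))"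
  using assms
proof (induction xs)
  case (Cons x xs)
  show ?case
  proof (cases "x = j")
    case True
    then show ?thesis by (intro exI[of _ 1]) (simp add: o_def)
  next
    case False
    with Cons.prems have "distinct xs" "j \<in> set xs" by auto
    from Cons.IH[OF this] obtain s :: int where "\<forall>v :: 'i \<Rightarrow> 'b \<Rightarrow>\<^sub>0 int. prod_list (map (\<lambda>i. ext_incl (v i)) xs)
        = of_int s * (ext_incl (v j) * prod_list (map ext_incl (map v (remove1 j xs))))" ..
    note s = this[rule_format]
    have "prod_list (map (\<lambda>i. ext_incl (v i)) (x # xs))
        = of_int (- s) * (ext_incl (v j) * prod_list (map ext_incl (map v (remove1 j (x # xs)))))"
      for v :: "'i \<Rightarrow> 'b \<Rightarrow>\<^sub>0 int"
    proof -
      let ?r = "prod_list (map ext_incl (map v (remove1 j xs)))"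
      have "prod_list (map (\<lambda>i. ext_incl (v i)) (x # xs)) = of_int s * (ext_incl (v x) * ext_incl (v j) * ?r)"
        by (simp add: s mult_of_int_commute[of s "ext_incl (v x)"] flip: mult.assoc)
      also have "ext_incl (v x) * ext_incl (v j) = - (ext_incl (v j) * ext_incl (v x))"
        by (rule ext_incl_anticomm)
      finally show ?thesis using False by (simp add: mult.assoc)
    qed
    then show ?thesis by blast
  qed
qed simp

lemma incl_mult_wedge_eq_0: "m \<in> set ms \<Longrightarrow> ext_incl m * prod_list (map ext_incl ms) = 0"
proof (induction ms)
  case (Cons n ms)
  have *: "ext_incl m * prod_list (map ext_incl (n # ms)) = ext_incl m * ext_incl n * prod_list (map ext_incl ms)"
    by (simp add: mult.assoc)
  show ?case
  proof (cases "m = n")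
    case True
    then show ?thesis unfolding * by (simp add: ext_incl_square)
  next
    case False
    then show ?thesis unfolding * ext_incl_anticomm[of m n] using Cons by (simp add: mult.assoc)
  qed
qed simp

lemma wedge_eq_0:
  assumes "distinct xs" "i \<in> set xs" "j \<in> set xs" "i \<noteq> j" "v i = v j"
  shows "prod_list (map (\<lambda>i. ext_incl (v i)) xs) = 0"
proof -
  have "i \<in> set (remove1 j xs)" using assms by simp
  then have "v j \<in> set (map v (remove1 j xs))" using assms(5) by (metis image_eqI list.set_map)
  then have "ext_incl (v j) * prod_list (map ext_incl (map v (remove1 j xs))) = 0"
    by (rule incl_mult_wedge_eq_0)
  moreover obtain s :: int where "prod_list (map (\<lambda>i. ext_incl (v i)) xs)
      = of_int s * (ext_incl (v j) * prod_list (map ext_incl (map v (remove1 j xs))))"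
    using wedge_move_to_front[OF assms(1,3)] by blast
  ultimately show ?thesis by simp
qed

lemma wedge_add:
  fixes v :: "'i \<Rightarrow> 'b \<Rightarrow>\<^sub>0 int"
  assumes "distinct xs" "j \<in> set xs"
  shows "prod_list (map (\<lambda>i. ext_incl ((v(j := m + n)) i)) xs)
    = prod_list (map (\<lambda>i. ext_incl ((v(j := m)) i)) xs) + prod_list (map (\<lambda>i. ext_incl ((v(j := n)) i)) xs)"
proof -
  have rest: "map (v(j := m)) (remove1 j xs) = map v (remove1 j xs)" for m
    using assms by auto
  from wedge_move_to_front[OF assms]
  obtain s :: int where "\<forall>v :: 'i \<Rightarrow> 'b \<Rightarrow>\<^sub>0 int. prod_list (map (\<lambda>i. ext_incl (v i)) xs)
      = of_int s * (ext_incl (v j) * prod_list (map ext_incl (map v (remove1 j xs))))" ..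
  note s = this[rule_format]
  show ?thesis
    unfolding s rest by (simp only: fun_upd_same ext_incl_add distrib_left distrib_right)
qed

lemma wedge_swap:
  assumes "distinct xs" "i \<in> set xs" "j \<in> set xs" "i \<noteq> j"
  shows "prod_list (map (\<lambda>l. ext_incl (v (transpose i j l))) xs) = - prod_list (map (\<lambda>l. ext_incl (v l)) xs)"
proof -
  define W where "W m n = prod_list (map (\<lambda>l. ext_incl ((v(i := m, j := n)) l)) xs)" for m n
  have add1: "W (m + m') n = W m n + W m' n" for m m' n
    using wedge_add[OF assms(1,2), of "v(j := n)" m m'] assms(4) by (simp add: W_def fun_upd_twist)
  have add2: "W m (n + n') = W m n + W m n'" for m n n'
    using wedge_add[OF assms(1,3), of "v(i := m)" n n'] by (simp add: W_def)
  have alt: "W m m = 0" for m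
    unfolding W_def using assms by (intro wedge_eq_0[of xs i j]) auto
  have "W (v i + v j) (v i + v j) = 0" by (rule alt)
  then have "W (v i) (v j) + W (v j) (v i) = 0"
    by (simp only: add1 add2 alt[of "v i"] alt[of "v j"] add_0_left add_0_right add.commute)
  then have "W (v j) (v i) = - W (v i) (v j)"
    by (simp add: eq_neg_iff_add_eq_0 add.commute)
  moreover have "v \<circ> transpose i j = v(i := v j, j := v i)"
    using assms(4) by (auto simp: fun_eq_iff transpose_def)
  then have "W (v j) (v i) = prod_list (map (\<lambda>l. ext_incl (v (transpose i j l))) xs)"
    by (simp add: W_def o_def fun_eq_iff)
  ultimately show ?thesis by (simp add: W_def)
qed

lemma wedge_permute:
  assumes "distinct xs" "p permutes set xs"
  shows "prod_list (map (\<lambda>l. ext_incl (v (p l))) xs) = of_int (sign p) * prod_list (map (\<lambda>l. ext_incl (v l)) xs)"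
  using assms(2)
proof (induction p arbitrary: v rule: permutes_induct[OF _ finite_set, consumes 1, case_names id swap])
  case (swap a b p)
  have "permutation p" using swap by (auto simp: permutation_permutes)
  with swap(5)[of "v \<circ> transpose a b"] swap(1-3) wedge_swap[OF assms(1), of a b v] show ?case
    by (simp add: sign_compose[unfolded o_def] permutation_swap_id sign_swap_id)
qed simp_all

section \<open>Giambelli's formula for operators on the exterior algebra\<close>

text \<open>The operators \<open>D\<^sub>n\<close> act here on the whole exterior algebra, so that they can be composed without
  domain conditions.\<close>

definition schubert_Dint :: "int \<Rightarrow> nat exterior \<Rightarrow> nat exterior" where
  "schubert_Dint n x = (if n < 0 then 0 else schubert_D (nat n) x)"

definition wedge_seq :: "nat \<Rightarrow> (nat \<Rightarrow> nat) \<Rightarrow> nat exterior" where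
  "wedge_seq k a = prod_list (map (\<lambda>i. ext_incl (eps (a i))) [1..<Suc k])"

text \<open>The operator \<open>det(D\<^bsub>a\<^sub>j - i\<^esub>)\<close> in Leibniz form. The factors commute, so the fold over \<open>{1..k}\<close>
  composes them in an arbitrary order.\<close>

definition det_apply :: "nat \<Rightarrow> (nat \<Rightarrow> nat) \<Rightarrow> nat exterior \<Rightarrow> nat exterior" where
  "det_apply k a x = (\<Sum>p | p permutes {1..k}. of_int (sign p) *
     Finite_Set.fold (\<lambda>i. schubert_Dint (int (a (p i)) - int i)) x {1..k})"

lemma comp_fun_commute_schubert_Dint: "comp_fun_commute (\<lambda>i. schubert_Dint (n i))"
  by unfold_locales
     (auto simp: fun_eq_iff schubert_Dint_def schubert_D_simps intro: schubert_D_commute)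

lemma wedge_seq_recurrence:
  assumes "j \<in> {1..k}" "k < a j"
  shows "(\<Sum>l<a j. schubert_Dinv l (wedge_seq k (a(j := a j - l)))) = 0"
proof -
  let ?xs = "[1..<Suc k]"
  have "distinct ?xs" "j \<in> set ?xs" using assms(1) by auto
  from wedge_move_to_front[OF this]
  obtain s :: int where "\<forall>v :: nat \<Rightarrow> nat \<Rightarrow>\<^sub>0 int. prod_list (map (\<lambda>i. ext_incl (v i)) ?xs)
      = of_int s * (ext_incl (v j) * prod_list (map ext_incl (map v (remove1 j ?xs))))" ..
  note s = this[rule_format]
  define ms where "ms = map (\<lambda>i. eps (a i)) (remove1 j ?xs)"
  have ms: "map (\<lambda>i. eps ((a(j := m)) i)) (remove1 j ?xs) = ms" for m
    unfolding ms_def by auto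
  have "wedge_seq k (a(j := a j - l)) = of_int s * (ext_incl (eps (a j - l)) * prod_list (map ext_incl ms))" for l
    unfolding wedge_seq_def s[of "\<lambda>i. eps ((a(j := a j - l)) i)"] ms by simp
  then have "(\<Sum>l<a j. schubert_Dinv l (wedge_seq k (a(j := a j - l))))
      = of_int s * (\<Sum>l<a j. schubert_Dinv l (ext_incl (eps (a j - l)) * prod_list (map ext_incl ms)))"
    by (simp add: additive_of_int[OF additive_schubert_Dinv] sum_distrib_left)
  moreover have "length ms < k"
    using assms(1) by (simp add: ms_def length_remove1)
  ultimately show ?thesis using sum_Dinv_eps_mult[of ms "a j"] assms(2) by simp
qed

text \<open>The coefficient of \<open>t\<^bsup>N-i\<^esup>\<close> in \<open>E\<^sub>t D\<^sub>t y = y\<close>, a positive degree; the terms with \<open>l > N - i\<close> contain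
  a \<open>D\<close> of negative index.\<close>

lemma sum_Dinv_Dint:
  assumes "1 \<le> i" "i < N"
  shows "(\<Sum>l<N. schubert_Dinv l (schubert_Dint (int N - int l - int i) y)) = 0"
proof -
  have "(\<Sum>l<N. schubert_Dinv l (schubert_Dint (int N - int l - int i) y))
      = (\<Sum>l\<le>N - i. schubert_Dinv l (schubert_D (N - i - l) y))"
  proof (rule sum.mono_neutral_cong_right)
    fix l assume l: "l \<in> {..N - i}"
    then have n: "int N - int l - int i = int (N - i - l)" using assms by auto
    show "schubert_Dinv l (schubert_Dint (int N - int l - int i) y)
        = schubert_Dinv l (schubert_D (N - i - l) y)"
      unfolding n by (simp add: schubert_Dint_def)
  qed (use assms in \<open>auto simp: schubert_Dint_def additive.zero[OF additive_schubert_Dinv]\<close>)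
  also have "\<dots> = 0" by (rule sum_Dinv_D) (use assms in simp)
  finally show ?thesis .
qed

lemma det_apply_recurrence:
  assumes j: "j \<in> {1..k}" and "k < a j"
  shows "(\<Sum>l<a j. schubert_Dinv l (det_apply k (a(j := a j - l)) x)) = 0"
proof -
  define T where "T p l = Finite_Set.fold (\<lambda>i. schubert_Dint (int ((a(j := a j - l)) (p i)) - int i)) x {1..k}" for p l
  have zero: "(\<Sum>l<a j. schubert_Dinv l (T p l)) = 0" if p: "p permutes {1..k}" for p
  proof -
    \<comment> \<open>The row in which the term of \<open>p\<close> picks its entry from column \<open>j\<close>.\<close>
    define i0 where "i0 = Hilbert_Choice.inv p j"
    have i0: "i0 \<in> {1..k}" using p j by (simp add: i0_def permutes_in_image permutes_inv del: atLeastAtMost_iff)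
    have pi: "p i = j \<longleftrightarrow> i = i0" for i
      unfolding i0_def using p by (metis permutes_inverses)
    define y where "y = Finite_Set.fold (\<lambda>i. schubert_Dint (int (a (p i)) - int i)) x ({1..k} - {i0})"
    have "T p l = schubert_Dint (int (a j) - int l - int i0) y" if "l < a j" for l
    proof -
      let ?f = "\<lambda>i. schubert_Dint (int ((a(j := a j - l)) (p i)) - int i)"
      interpret comp_fun_commute ?f by (rule comp_fun_commute_schubert_Dint)
      have "T p l = ?f i0 (Finite_Set.fold ?f x ({1..k} - {i0}))"
        unfolding T_def by (rule fold_rec) (use i0 in auto)
      also have "Finite_Set.fold ?f x ({1..k} - {i0}) = y"
        unfolding y_def by (rule fold_closed_eq[where B = UNIV]) (auto simp: pi)
      also have "int ((a(j := a j - l)) (p i0)) - int i0 = int (a j) - int l - int i0"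
        using that pi[of i0] by simp
      finally show ?thesis .
    qed
    then show ?thesis using sum_Dinv_Dint[of i0 "a j" y] i0 assms(2) by simp
  qed
  have "(\<Sum>l<a j. schubert_Dinv l (det_apply k (a(j := a j - l)) x))
      = (\<Sum>p | p permutes {1..k}. of_int (sign p) * (\<Sum>l<a j. schubert_Dinv l (T p l)))"
    unfolding det_apply_def T_def[symmetric]
    by (simp add: additive.sum[OF additive_schubert_Dinv] additive_of_int[OF additive_schubert_Dinv]
        sum_distrib_left) (rule sum.swap)
  then show ?thesis by (simp add: zero)
qed

text \<open>Exchanging the two columns matches the even permutations with the odd ones, so the terms cancel
  in pairs. Mere antisymmetry would only give that twice the value vanishes.\<close>

lemma det_apply_equal_columns:
  assumes ij: "i \<in> {1..k}" "j \<in> {1..k}" "i \<noteq> j" and "a i = a j"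
  shows "det_apply k a x = 0"
proof -
  let ?S = "{p. p permutes {1..k}}"
  let ?t = "transpose i j"
  define T where "T p = Finite_Set.fold (\<lambda>i. schubert_Dint (int (a (p i)) - int i)) x {1..k}" for p
  have t: "?t permutes {1..k}" using ij by (simp add: permutes_swap_id)
  have T: "T (?t \<circ> p) = T p" for p
  proof -
    have "a (?t m) = a m" for m using assms(4) by (auto simp: transpose_def)
    then show ?thesis by (simp add: T_def)
  qed
  have S: "?t \<circ> p \<in> ?S" "evenperm (?t \<circ> p) \<longleftrightarrow> \<not> evenperm p" if "p \<in> ?S" for p
  proof -
    show "?t \<circ> p \<in> ?S" using that t by (simp add: permutes_compose)
    have "permutation p" using that permutation_permutes[of p] by auto
    then show "evenperm (?t \<circ> p) \<longleftrightarrow> \<not> evenperm p"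
      using ij(3) by (simp add: evenperm_comp permutation_swap_id evenperm_swap)
  qed
  have fin: "finite ?S" by (rule finite_permutations) simp
  have "det_apply k a x = (\<Sum>p\<in>?S. if evenperm p then T p else - T p)"
    unfolding det_apply_def T_def[symmetric] by (rule sum.cong) (simp_all add: sign_def)
  also have "\<dots> = (\<Sum>p\<in>{p\<in>?S. evenperm p}. T p) - (\<Sum>p\<in>{p\<in>?S. \<not> evenperm p}. T p)"
    using fin by (simp add: sum.If_cases sum_negf Int_def conj_commute)
  also have "(\<Sum>p\<in>{p\<in>?S. evenperm p}. T p) = (\<Sum>p\<in>{p\<in>?S. \<not> evenperm p}. T p)"
    by (rule sum.reindex_bij_witness[of _ "\<lambda>p. ?t \<circ> p" "\<lambda>p. ?t \<circ> p"])
       (use S T in \<open>auto simp: o_assoc[symmetric] fun_eq_iff\<close>)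
  finally show ?thesis by simp
qed

lemma fold_schubert_Dint_eq_0:
  assumes "finite A" "i \<in> A" "n i < 0"
  shows "Finite_Set.fold (\<lambda>i. schubert_Dint (n i)) x A = 0"
proof -
  interpret comp_fun_commute "\<lambda>i. schubert_Dint (n i)" by (rule comp_fun_commute_schubert_Dint)
  show ?thesis using fold_rec[OF assms(1,2)] assms(3) by (simp add: schubert_Dint_def)
qed

lemma fold_schubert_Dint_eq_id:
  assumes "finite A" "\<And>i. i \<in> A \<Longrightarrow> n i = 0"
  shows "Finite_Set.fold (\<lambda>i. schubert_Dint (n i)) x A = x"
proof -
  interpret comp_fun_commute "\<lambda>i. schubert_Dint (n i)" by (rule comp_fun_commute_schubert_Dint)
  from assms show ?thesis
    by (induction A rule: finite_induct) (simp_all add: schubert_Dint_def schubert_D_0)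
qed

text \<open>A term can be nonzero only if \<open>q (p i) \<ge> i\<close> for all \<open>i\<close>, which forces \<open>q \<circ> p = id\<close>; that term is
  \<open>D\<^sub>0 \<circ> \<dots> \<circ> D\<^sub>0\<close>.\<close>

lemma det_apply_permutation:
  assumes q: "q permutes {1..k}"
  shows "det_apply k q x = of_int (sign q) * x"
proof -
  let ?S = "{p. p permutes {1..k}}"
  define T where "T p = Finite_Set.fold (\<lambda>i. schubert_Dint (int (q (p i)) - int i)) x {1..k}" for p
  have iq: "Hilbert_Choice.inv q \<in> ?S" using q by (simp add: permutes_inv)
  have "T p = 0" if p: "p \<in> ?S - {Hilbert_Choice.inv q}" for p
  proof -
    have qp: "q \<circ> p permutes {1..k}" using p q by (simp add: permutes_compose)
    have "\<exists>i\<in>{1..k}. (q \<circ> p) i < i"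
    proof (rule ccontr)
      assume "\<not> ?thesis"
      then have "\<forall>i\<in>{1..k}. i \<le> (q \<circ> p) i" by auto
      then have "q \<circ> p = id" using qp by (intro permutes_natset_ge) auto
      then have "p = Hilbert_Choice.inv q" using q by (metis permutes_inv_o(2) comp_assoc comp_id id_comp)
      then show False using p by simp
    qed
    then show ?thesis unfolding T_def
      by (elim bexE) (rule fold_schubert_Dint_eq_0, auto)
  qed
  then have "det_apply k q x = of_int (sign (Hilbert_Choice.inv q)) * T (Hilbert_Choice.inv q)"
    unfolding det_apply_def T_def[symmetric] using iq
    by (subst sum.mono_neutral_right[of ?S "{Hilbert_Choice.inv q}"]) (auto simp: finite_permutations)
  also have "T (Hilbert_Choice.inv q) = x"
    unfolding T_def by (rule fold_schubert_Dint_eq_id) (simp_all add: permutes_inverses[OF q])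
  also have "sign (Hilbert_Choice.inv q) = sign q"
    using q permutation_permutes[of q] by (intro sign_inverse) auto
  finally show ?thesis .
qed

theorem wedge_seq_eq_det_apply:
  assumes "\<And>j. j \<in> {1..k} \<Longrightarrow> 1 \<le> a j"
  shows "wedge_seq k a = det_apply k a (wedge_seq k id)"
  using assms
proof (induction "sum a {1..k}" arbitrary: a rule: less_induct)
  case less
  let ?w = "wedge_seq k id"
  consider (big) j where "j \<in> {1..k}" "k < a j"
    | (equal) i j where "i \<in> {1..k}" "j \<in> {1..k}" "i \<noteq> j" "a i = a j"
    | (perm) "\<forall>j\<in>{1..k}. a j \<in> {1..k}" "inj_on a {1..k}"
    using less.prems unfolding inj_on_def by (metis atLeastAtMost_iff not_le)
  then show ?case
  proof cases
    case big
    let ?b = "\<lambda>l. a(j := a j - l)"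
    have smaller: "wedge_seq k (?b (Suc l)) = det_apply k (?b (Suc l)) ?w" if "Suc l < a j" for l
    proof (rule less.hyps)
      show "sum (?b (Suc l)) {1..k} < sum a {1..k}"
        using big that by (intro sum_strict_mono_ex1) auto
    qed (use less.prems that in auto)
    \<comment> \<open>As \<open>E\<^sub>0 = id\<close>, the recurrence can be solved for its term \<open>l = 0\<close>.\<close>
    obtain N where N: "a j = Suc N" using big by (cases "a j") auto
    have rec: "f a = - (\<Sum>l<N. schubert_Dinv (Suc l) (f (?b (Suc l))))"
      if "(\<Sum>l<a j. schubert_Dinv l (f (?b l))) = 0" for f :: "(nat \<Rightarrow> nat) \<Rightarrow> nat exterior"
      using that unfolding N sum.lessThan_Suc_shift by (simp add: eq_neg_iff_add_eq_0 flip: N)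
    have "wedge_seq k a = - (\<Sum>l<N. schubert_Dinv (Suc l) (wedge_seq k (?b (Suc l))))"
      by (rule rec, rule wedge_seq_recurrence[of j k a]) (use big in auto)
    also have "\<dots> = - (\<Sum>l<N. schubert_Dinv (Suc l) (det_apply k (?b (Suc l)) ?w))"
      using smaller N by simp
    also have "\<dots> = det_apply k a ?w"
      by (rule rec[symmetric], rule det_apply_recurrence[of j k a]) (use big in auto)
    finally show ?thesis .
  next
    case equal
    have "wedge_seq k a = 0"
      unfolding wedge_seq_def using equal
      by (intro wedge_eq_0[of "[1..<Suc k]" i j "\<lambda>i. eps (a i)"]) auto
    then show ?thesis using det_apply_equal_columns[OF equal] by simp
  next
    case perm
    define q where "q j = (if j \<in> {1..k} then a j else j)" for j
    have "a ` {1..k} = {1..k}"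
      using perm by (intro card_subset_eq) (auto simp: card_image)
    then have "bij_betw a {1..k} {1..k}"
      using perm(2) by (simp add: bij_betw_def)
    then have "bij_betw q {1..k} {1..k}"
      by (rule bij_betw_cong[THEN iffD1, rotated]) (simp add: q_def)
    then have q: "q permutes {1..k}"
      by (rule bij_imp_permutes) (auto simp: q_def)
    have "wedge_seq k a = wedge_seq k q"
      unfolding wedge_seq_def by (intro arg_cong[where f = prod_list] map_cong) (auto simp: q_def)
    also have "\<dots> = of_int (sign q) * ?w"
      using wedge_permute[of "[1..<Suc k]" q eps] q by (simp add: wedge_seq_def atLeastLessThanSuc_atLeastAtMost del: upt_Suc)
    also have "\<dots> = det_apply k q ?w" by (simp add: det_apply_permutation[OF q])
    also have "\<dots> = det_apply k a ?w"
    proof -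
      have "q (p i) = a (p i)" if "p permutes {1..k}" "i \<in> {1..k}" for p i
        using permutes_in_image[OF that(1)] that(2) by (simp add: q_def)
      then show ?thesis unfolding det_apply_def
        by (intro sum.cong refl arg_cong2[where f = "(*)"] fold_closed_eq[where B = UNIV]) auto
    qed
    finally show ?thesis .
  qed
qed

section \<open>Evaluation of elements of the ring of Schubert operators\<close>

lemma schubert_ring_eval:
  assumes "x \<in> ext_power k"
  shows "(f \<oplus>\<^bsub>schubert_ring k\<^esub> g) x = f x + g x"
    and "(f \<otimes>\<^bsub>schubert_ring k\<^esub> g) x = f (g x)"
    and "\<zero>\<^bsub>schubert_ring k\<^esub> x = 0"
    and "\<one>\<^bsub>schubert_ring k\<^esub> x = x"
    and "schubert_coeff k n x = schubert_Dint n x"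
  using assms
  by (simp_all add: schubert_ring_def End_ring_def ext_power_group_def compose_def
      schubert_coeff_def schubert_Dint_def schubert_End_def)

lemma schubert_ring_closed:
  assumes "f \<in> carrier (schubert_ring k)" "x \<in> ext_power k"
  shows "f x \<in> ext_power k"
proof -
  interpret R: ring "End_ring (ext_power_group k) :: (nat exterior \<Rightarrow> nat exterior) ring"
    by (rule ring_End_ring[OF comm_group_ext_power])
  have "f \<in> carrier (End_ring (ext_power_group k))"
    using assms(1) by (auto simp: schubert_ring_def schubert_End_carrier intro: R.generate_ring_in_carrier[rotated])
  then show ?thesis using assms(2) by (auto simp: End_ring_def ext_power_group_def hom_def)
qed

lemma schubert_ring_minus_eval:
  assumes "f \<in> carrier (schubert_ring k)" "x \<in> ext_power k"
  shows "(\<ominus>\<^bsub>schubert_ring k\<^esub> f) x = - f x"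
proof -
  interpret cring "schubert_ring k" by (rule cring_schubert_ring)
  have "(\<ominus>\<^bsub>schubert_ring k\<^esub> f \<oplus>\<^bsub>schubert_ring k\<^esub> f) x = 0"
    using assms by (simp add: l_neg schubert_ring_eval)
  then show ?thesis using assms(2) by (simp add: schubert_ring_eval eq_neg_iff_add_eq_0)
qed

lemma schubert_ring_sign_eval:
  assumes "f \<in> carrier (schubert_ring k)" "x \<in> ext_power k"
  shows "([sign p] \<cdot>\<^bsub>schubert_ring k\<^esub> f) x = of_int (sign p) * f x"
proof -
  interpret cring "schubert_ring k" by (rule cring_schubert_ring)
  show ?thesis
    using assms by (simp add: sign_def add_pow_int_lt add_pow_int_ge schubert_ring_minus_eval)
qed

lemma schubert_ring_finsum_eval:
  assumes "finite A" "f \<in> A \<rightarrow> carrier (schubert_ring k)" "x \<in> ext_power k"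
  shows "(\<Oplus>\<^bsub>schubert_ring k\<^esub>p\<in>A. f p) x = (\<Sum>p\<in>A. f p x)"
proof -
  interpret cring "schubert_ring k" by (rule cring_schubert_ring)
  show ?thesis using assms
    by (induction A rule: finite_induct) (simp_all add: schubert_ring_eval Pi_def)
qed

lemma schubert_ring_finprod_eval:
  assumes "finite A" "x \<in> ext_power k"
  shows "(\<Otimes>\<^bsub>schubert_ring k\<^esub>i\<in>A. schubert_coeff k (n i)) x
    = Finite_Set.fold (\<lambda>i. schubert_Dint (n i)) x A"
  using assms(1)
proof (induction A rule: finite_induct)
  case empty
  interpret cring "schubert_ring k" by (rule cring_schubert_ring)
  show ?case using assms(2) by (simp add: schubert_ring_eval)
next
  case (insert i A)
  interpret cring "schubert_ring k" by (rule cring_schubert_ring)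
  interpret comp_fun_commute "\<lambda>i. schubert_Dint (n i)" by (rule comp_fun_commute_schubert_Dint)
  let ?P = "\<Otimes>\<^bsub>schubert_ring k\<^esub>i\<in>A. schubert_coeff k (n i)"
  have "?P x \<in> ext_power k"
    by (intro schubert_ring_closed[OF _ assms(2)] finprod_closed) (simp add: schubert_coeff_carrier)
  then show ?case
    using insert assms(2) by (simp add: finprod_insert schubert_coeff_carrier schubert_ring_eval)
qed

text \<open>Unlike \<^const>\<open>schubert_Delta\<close>, this allows index sequences with \<open>a j < j\<close>, so that every wedge product of basis vectors can be reached without reordering its factors.\<close>

definition giambelli_det :: "nat \<Rightarrow> (nat \<Rightarrow> nat) \<Rightarrow> nat exterior \<Rightarrow> nat exterior" where
  "giambelli_det k a = ring_det (schubert_ring k) k (\<lambda>i j. schubert_coeff k (int (a j) - int i))"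

lemma schubert_Delta_eq_giambelli_det: "schubert_Delta k r = giambelli_det k (\<lambda>j. j + r j)"
  by (simp add: schubert_Delta_def giambelli_det_def add.commute)

lemma giambelli_det_carrier: "giambelli_det k a \<in> carrier (schubert_ring k)"
proof -
  interpret cring "schubert_ring k" by (rule cring_schubert_ring)
  show ?thesis unfolding giambelli_det_def ring_det_def
    by (intro finsum_closed funcsetI add.int_pow_closed[folded add_pow_def] finprod_closed)
       (simp add: schubert_coeff_carrier)
qed

lemma giambelli_det_eval:
  assumes "x \<in> ext_power k"
  shows "giambelli_det k a x = det_apply k a x"
proof -
  interpret cring "schubert_ring k" by (rule cring_schubert_ring)
  have P: "(\<Otimes>\<^bsub>schubert_ring k\<^esub>i\<in>{1..k}. schubert_coeff k (n i)) \<in> carrier (schubert_ring k)" for n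
    by (intro finprod_closed) (simp add: schubert_coeff_carrier)
  then have S: "[c] \<cdot>\<^bsub>schubert_ring k\<^esub> (\<Otimes>\<^bsub>schubert_ring k\<^esub>i\<in>{1..k}. schubert_coeff k (n i))
      \<in> carrier (schubert_ring k)" for n and c :: int
    by (rule add.int_pow_closed)
  show ?thesis
    unfolding giambelli_det_def ring_det_def det_apply_def
    by (subst schubert_ring_finsum_eval)
       (use assms in \<open>simp_all add: finite_permutations P S schubert_ring_sign_eval
          schubert_ring_finprod_eval del: One_nat_def\<close>)
qed

lemma wedge_eps_map: "wedge_eps (map a [1..<Suc k]) = wedge_seq k a"
  by (simp add: wedge_eps_def wedge_seq_def o_def del: upt_Suc)

lemma wedge_seq_ext_power: "wedge_seq k a \<in> ext_power k"
  using ext_power_prod[of "map (\<lambda>i. eps (a i)) [1..<Suc k]" k]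
  by (simp add: wedge_seq_def o_def del: upt_Suc)

theorem giambelli:
  assumes "\<And>j. j \<in> {1..k} \<Longrightarrow> 1 \<le> a j"
  shows "giambelli_det k a (wedge_eps [1..<Suc k]) = wedge_eps (map a [1..<Suc k])"
  using wedge_seq_eq_det_apply[of k a, OF assms] wedge_eps_map[of id k]
  by (simp add: giambelli_det_eval wedge_seq_ext_power wedge_eps_map del: upt_Suc One_nat_def)

section \<open>Surjectivity\<close>

text \<open>The wedge products of basis vectors span the exterior power: the vectors of a product are expanded
  from left to right, the prefix \<open>js\<close> being the part already expanded.\<close>

lemma ext_power_eps_induct [consumes 1, case_names zero eps diff]:
  assumes "x \<in> ext_power k" and zero: "P 0"
    and eps: "\<And>js. length js = k \<Longrightarrow> (\<And>j. j \<in> set js \<Longrightarrow> 1 \<le> j) \<Longrightarrow> P (wedge_eps js)"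
    and diff: "\<And>x y. P x \<Longrightarrow> P y \<Longrightarrow> P (x - y)"
  shows "P x"
  using assms(1)
proof (induction x rule: ext_power_induct)
  case (prod ms)
  have "P (wedge_eps js * prod_list (map ext_incl ms))"
    if "length js + length ms = k" "\<And>j. j \<in> set js \<Longrightarrow> 1 \<le> j" for js
    using that
  proof (induction ms arbitrary: js)
    case Nil
    then show ?case by (simp add: eps)
  next
    case (Cons m ms)
    show ?case
    proof (induction m rule: frag_induct)
      case zero
      have "ext_incl 0 = (0 :: nat exterior)" using ext_incl_add[of 0 0] by simp
      then show ?case by (simp add: assms(2))
    next
      case (one b)
      have "P (wedge_eps (js @ [Suc b]) * prod_list (map ext_incl ms))"
        by (rule Cons.IH) (use Cons.prems in auto)
      then show ?case by (simp add: wedge_eps_def eps_def mult.assoc)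
    next
      case (diff m n)
      have "ext_incl (m - n) = ext_incl m - ext_incl n"
        using ext_incl_add[of "m - n" n] by simp
      then show ?case using assms(4)[OF diff] by (simp add: left_diff_distrib right_diff_distrib)
    qed
  qed
  from this[of "[]"] prod show ?case by (simp add: wedge_eps_def)
qed (use zero diff in auto)

lemma evaluation_surjective:
  assumes "x \<in> ext_power k"
  shows "\<exists>P\<in>carrier (schubert_ring k). P (wedge_eps [1..<Suc k]) = x"
proof -
  interpret cring "schubert_ring k" by (rule cring_schubert_ring)
  let ?w = "wedge_eps [1..<Suc k]"
  have w: "?w \<in> ext_power k"
    using wedge_seq_ext_power[of k id] wedge_eps_map[of id k] by simp
  from assms show ?thesis
  proof (induction x rule: ext_power_eps_induct)
    case zero
    show ?case by (rule bexI[of _ "\<zero>\<^bsub>schubert_ring k\<^esub>"]) (simp_all add: schubert_ring_eval w del: upt_Suc One_nat_def)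
  next
    case (eps js)
    let ?a = "\<lambda>i. js ! (i - 1)"
    have "js = map ?a [1..<Suc k]"
      using eps(1) by (intro nth_equalityI) (simp_all del: upt_Suc)
    moreover have "giambelli_det k ?a ?w = wedge_eps (map ?a [1..<Suc k])"
      by (rule giambelli) (use eps in auto)
    ultimately show ?case using giambelli_det_carrier by metis
  next
    case (diff x y)
    then obtain P Q where "P \<in> carrier (schubert_ring k)" "Q \<in> carrier (schubert_ring k)"
      "P ?w = x" "Q ?w = y" by blast
    then show ?case
      by (intro bexI[of _ "P \<oplus>\<^bsub>schubert_ring k\<^esub> (\<ominus>\<^bsub>schubert_ring k\<^esub> Q)"])
         (simp_all add: schubert_ring_eval schubert_ring_minus_eval w del: upt_Suc One_nat_def)
  qed
qed

theorem theorem3p1: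
  fixes k :: nat and r :: "nat \<Rightarrow> nat"
  assumes "k \<ge> 1" and "mono_on {1..k} r"
  shows "(\<lambda>P. P (wedge_eps [1..<Suc k])) \<in> epi (add_monoid (schubert_ring k)) (ext_power_group k)
    \<and> schubert_Delta k r (wedge_eps [1..<Suc k]) = wedge_eps (map (\<lambda>i. i + r i) [1..<Suc k])"
proof
  have w: "wedge_eps [1..<Suc k] \<in> ext_power k"
    using wedge_seq_ext_power[of k id] wedge_eps_map[of id k] by simp
  show "(\<lambda>P. P (wedge_eps [1..<Suc k])) \<in> epi (add_monoid (schubert_ring k)) (ext_power_group k)"
    using evaluation_surjective[of _ k] schubert_ring_closed[OF _ w] schubert_ring_eval(1)[OF w]
    by (auto simp: epi_def hom_def ext_power_group_def image_iff simp del: upt_Suc One_nat_def)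
  show "schubert_Delta k r (wedge_eps [1..<Suc k]) = wedge_eps (map (\<lambda>i. i + r i) [1..<Suc k])"
    unfolding schubert_Delta_eq_giambelli_det by (rule giambelli) simp
qed

end
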